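(* Let $\mathscr{F}\subseteq\mathscr{P}(\omega)$ be a nonempty $\omega$-closed family. The semigroup $\boldsymbol{B}_{\omega}^{\mathscr{F}}$ contains an identity element if and only if the family $\mathscr{F}$ contains an inductive set $F_0$ in $\omega$ such that $F_0=\bigcup\mathscr{F}$. Under these conditions the element $(0,0,F_0)$ is the identity of $\boldsymbol{B}_{\omega}^{\mathscr{F}}$.
   Context: $\omega$ is the set of non-negative integers, $\mathscr{P}(\omega)$ its power set. A subset $A\subseteq\omega$ is inductive if $i\in A$ implies $i+1\in A$ (so $\varnothing$ is inductive). For an integer $n$ and $F\subseteq\omega$ put $n+F=\{n+k\colon k\in F\}\subseteq\mathbb{Z}$ (empty if $F=\varnothing$). A family $\mathscr{F}\subseteq\mathscr{P}(\omega)$ is $\omega$-closed if $F_1\cap(-n+F_2)\in\mathscr{F}$ for all $n\in\omega$ and $F_1,F_2\in\mathscr{F}$. For an $\omega$-closed family $\mathscr{F}$, the set $\boldsymbol{B}_{\omega}\times\mathscr{F}=\omega\times\omega\times\mathscr{F}$ carries the semigroup operation $$(i_1,j_1,F_1)\cdot(i_2,j_2,F_2)=\begin{cases}(i_1-j_1+i_2,\,j_2,\,(j_1-i_2+F_1)\cap F_2), & j_1\leqslant i_2;\\ (i_1,\,j_1-i_2+j_2,\,F_1\cap(i_2-j_1+F_2)), & j_1\geqslant i_2.\end{cases}$$ If $\varnothing\notin\mathscr{F}$, then $\boldsymbol{B}_{\omega}^{\mathscr{F}}=(\boldsymbol{B}_{\omega}\times\mathscr{F},\cdot)$. If $\varnothing\in\mathscr{F}$,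 then $\boldsymbol{I}=\{(i,j,\varnothing)\colon i,j\in\omega\}$ is an ideal and $\boldsymbol{B}_{\omega}^{\mathscr{F}}$ is the Rees quotient $(\boldsymbol{B}_{\omega}\times\mathscr{F},\cdot)/\boldsymbol{I}$, in which all $(i,j,\varnothing)$ are identified to a single zero element $\boldsymbol{0}$ (so $(i,j,\varnothing)$ denotes $\boldsymbol{0}$). *)

theory Defs
  imports Main
begin

text \<open>The set \<open>\<omega>\<close> is the type \<^typ>\<open>nat\<close>.\<close>

definition omega_inductive :: "nat set \<Rightarrow> bool" where
  "omega_inductive A \<longleftrightarrow> (\<forall>i\<in>A. i + 1 \<in> A)"

definition shift :: "int \<Rightarrow> nat set \<Rightarrow> int set" where
  "shift n F = (\<lambda>k. n + int k) ` F"

text \<open>Intersection of a set of integers with a subset of \<open>\<omega>\<close>, as a subset of \<open>\<omega>\<close>.\<close>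

definition int_cap :: "int set \<Rightarrow> nat set \<Rightarrow> nat set" where
  "int_cap Z F = {k \<in> F. int k \<in> Z}"

definition omega_closed :: "nat set set \<Rightarrow> bool" where
  "omega_closed \<F> \<longleftrightarrow>
     (\<forall>n::nat. \<forall>F1\<in>\<F>. \<forall>F2\<in>\<F>. int_cap (shift (- int n) F2) F1 \<in> \<F>)"

type_synonym triple = "nat \<times> nat \<times> nat set"

definition triples :: "nat set set \<Rightarrow> triple set" where
  "triples \<F> = UNIV \<times> UNIV \<times> \<F>"

text \<open>
  In each case below the truncated subtraction is applied to arguments for which it agrees
  with integer subtraction; the two cases agree for \<open>j1 = i2\<close>, see \<open>triple_mult_ge\<close>.
\<close>

fun triple_mult :: "triple \<Rightarrow> triple \<Rightarrow> triple" where
  "triple_mult (i1, j1, F1) (i2, j2, F2) =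
     (if j1 \<le> i2
      then (i1 + (i2 - j1), j2, int_cap (shift (int j1 - int i2) F1) F2)
      else (i1, (j1 - i2) + j2, int_cap (shift (int i2 - int j1) F2) F1))"

definition zero_ideal :: "nat set set \<Rightarrow> triple set" where
  "zero_ideal \<F> = {(i, j, F) \<in> triples \<F>. F = {}}"

definition rees_congruence :: "'a set \<Rightarrow> 'a set \<Rightarrow> ('a \<times> 'a) set" where
  "rees_congruence S I = {(x, y). x \<in> S \<and> y \<in> S \<and> (x = y \<or> x \<in> I \<and> y \<in> I)}"

text \<open>
  Elements of the semigroup are classes of triples.  If \<open>{} \<in> \<F>\<close>, this is the Rees quotient
  by \<open>zero_ideal \<F>\<close>.  If \<open>{} \<notin> \<F>\<close>, then \<open>zero_ideal \<F>\<close> is empty, all classes are singletons,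
  and the quotient is the semigroup of triples itself up to the isomorphism
  \<open>x \<mapsto> {x}\<close> (lemma \<open>no_empty_set_iso\<close>).
\<close>

abbreviation B_rel :: "nat set set \<Rightarrow> (triple \<times> triple) set" where
  "B_rel \<F> \<equiv> rees_congruence (triples \<F>) (zero_ideal \<F>)"

definition B_carrier :: "nat set set \<Rightarrow> triple set set" where
  "B_carrier \<F> = triples \<F> // B_rel \<F>"

definition B_class :: "nat set set \<Rightarrow> triple \<Rightarrow> triple set" where
  "B_class \<F> x = B_rel \<F> `` {x}"

definition B_mult :: "nat set set \<Rightarrow> triple set \<Rightarrow> triple set \<Rightarrow> triple set" where
  "B_mult \<F> X Y = (\<Union>x\<in>X. \<Union>y\<in>Y. B_class \<F> (triple_mult x y))"

definition is_identity :: "'a set \<Rightarrow> ('a \<Rightarrow> 'a \<Rightarrow> 'a) \<Rightarrow> 'a \<Rightarrow> bool" where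
  "is_identity S mul e \<longleftrightarrow> e \<in> S \<and> (\<forall>x\<in>S. mul e x = x \<and> mul x e = x)"

lemma mem_int_cap_shift: "k \<in> int_cap (shift n F) G \<longleftrightarrow> k \<in> G \<and> (\<exists>l\<in>F. int k = n + int l)"
  by (auto simp: int_cap_def shift_def)

lemma triple_mult_ge:
  assumes "j1 \<ge> i2"
  shows "triple_mult (i1, j1, F1) (i2, j2, F2) =
     (i1, (j1 - i2) + j2, int_cap (shift (int i2 - int j1) F2) F1)"
  using assms by (auto simp: mem_int_cap_shift)

lemma triple_mult_closed:
  assumes "omega_closed \<F>" "x \<in> triples \<F>" "y \<in> triples \<F>"
  shows "triple_mult x y \<in> triples \<F>"
proof -
  obtain i1 j1 F1 i2 j2 F2 where xy: "x = (i1, j1, F1)" "y = (i2, j2, F2)"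
    by (metis prod_cases3)
  have F: "F1 \<in> \<F>" "F2 \<in> \<F>" using assms xy by (auto simp: triples_def)
  have *: "int_cap (shift (- int n) A) B \<in> \<F>" if "A \<in> \<F>" "B \<in> \<F>" for n A B
    using assms(1) that by (auto simp: omega_closed_def)
  show ?thesis
    using *[OF F(1) F(2), of "i2 - j1"] *[OF F(2) F(1), of "j1 - i2"] xy
    by (auto simp: triples_def of_nat_diff)
qed

lemma triple_mult_assoc: "triple_mult (triple_mult x y) z = triple_mult x (triple_mult y z)"
proof -
  have comp: "k \<in> int_cap (shift n F) G \<longleftrightarrow> k \<in> G \<and> int k - n \<in> int ` F" for k n F G
    by (force simp: mem_int_cap_shift)
  have ex: "a \<in> int ` int_cap (shift n F) G \<longleftrightarrow> a \<in> int ` G \<and> a - n \<in> int ` F" for a n F G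
    using comp by auto
  obtain i1 j1 F1 i2 j2 F2 i3 j3 F3
    where "x = (i1, j1, F1)" "y = (i2, j2, F2)" "z = (i3, j3, F3)"
    by (metis prod_cases3)
  then show ?thesis
    by (auto simp: comp ex set_eq_iff of_nat_diff algebra_simps)
qed

lemma zero_ideal_ideal:
  assumes "omega_closed \<F>" "x \<in> zero_ideal \<F>" "y \<in> triples \<F>"
  shows "triple_mult x y \<in> zero_ideal \<F>" "triple_mult y x \<in> zero_ideal \<F>"
proof -
  have x: "x \<in> triples \<F>" using assms(2) by (auto simp: zero_ideal_def)
  show "triple_mult x y \<in> zero_ideal \<F>" "triple_mult y x \<in> zero_ideal \<F>"
    using triple_mult_closed[OF assms(1) x assms(3)] triple_mult_closed[OF assms(1,3) x] assms(2)
    by (cases x; cases y; auto simp: zero_ideal_def int_cap_def shift_def)+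
qed

lemma B_rel_equiv: "equiv (triples \<F>) (B_rel \<F>)"
  by (intro equivI refl_onI symI transI) (auto simp: rees_congruence_def)

lemma B_rel_congruent:
  assumes "omega_closed \<F>"
  shows "congruent2 (B_rel \<F>) (B_rel \<F>) (\<lambda>x y. B_class \<F> (triple_mult x y))"
proof (rule congruent2I')
  fix x x' y y'
  assume "(x, x') \<in> B_rel \<F>" "(y, y') \<in> B_rel \<F>"
  then have "(triple_mult x y, triple_mult x' y') \<in> B_rel \<F>"
    unfolding rees_congruence_def mem_Collect_eq case_prod_conv
    by (metis assms triple_mult_closed zero_ideal_ideal)
  then show "B_class \<F> (triple_mult x y) = B_class \<F> (triple_mult x' y')"
    unfolding B_class_def by (rule equiv_class_eq[OF B_rel_equiv])
qed

lemma B_mult_class: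
  assumes "omega_closed \<F>" "x \<in> triples \<F>" "y \<in> triples \<F>"
  shows "B_mult \<F> (B_class \<F> x) (B_class \<F> y) = B_class \<F> (triple_mult x y)"
  unfolding B_mult_def B_class_def[of \<F> x] B_class_def[of \<F> y]
  using UN_equiv_class2[OF B_rel_equiv B_rel_equiv B_rel_congruent[OF assms(1)] assms(2,3)] .

lemma no_empty_set_iso:
  assumes "omega_closed \<F>" "{} \<notin> \<F>"
  shows "bij_betw (\<lambda>x. {x}) (triples \<F>) (B_carrier \<F>)"
    and "x \<in> triples \<F> \<Longrightarrow> B_class \<F> x = {x}"
    and "x \<in> triples \<F> \<Longrightarrow> y \<in> triples \<F> \<Longrightarrow> B_mult \<F> {x} {y} = {triple_mult x y}"
proof -
  have cls: "B_class \<F> x = {x}" if "x \<in> triples \<F>" for x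
    using that assms(2) by (auto simp: B_class_def rees_congruence_def zero_ideal_def triples_def)
  show "x \<in> triples \<F> \<Longrightarrow> B_class \<F> x = {x}" by (rule cls)
  show "x \<in> triples \<F> \<Longrightarrow> y \<in> triples \<F> \<Longrightarrow> B_mult \<F> {x} {y} = {triple_mult x y}"
    using triple_mult_closed[OF assms(1)] by (simp add: B_mult_def cls del: triple_mult.simps)
  have "B_carrier \<F> = (\<lambda>x. {x}) ` triples \<F>"
    using cls by (auto simp: B_carrier_def quotient_def B_class_def)
  then show "bij_betw (\<lambda>x. {x}) (triples \<F>) (B_carrier \<F>)"
    by (simp add: bij_betw_def)
qed

lemma empty_set_zero:
  assumes "{} \<in> \<F>"
  shows "B_class \<F> (i, j, {}) = zero_ideal \<F>"
  using assms by (auto simp: B_class_def rees_congruence_def zero_ideal_def triples_def)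

end

theory Submission
  imports Defs
begin

text \<open>
  Multiplying a triple \<open>(i, j, F)\<close> by \<open>(0, 0, G)\<close> on the left replaces \<open>F\<close> by \<open>F \<inter> (- i + G)\<close>,
  and on the right by \<open>F \<inter> (- j + G)\<close>; the coordinates \<open>i, j\<close> do not change.  Hence \<open>(0, 0, G)\<close>
  is an identity as soon as every translate \<open>- n + G\<close> contains every \<open>F \<in> \<F>\<close>, which holds when
  \<open>G = \<Union>\<F>\<close> is inductive (\<open>union_inductive_identity\<close>).

  Conversely, let the class of \<open>(i, j, G)\<close> be an identity.  Nonzero elements of the Rees quotient
  are classes with a single triple, so testing the identity on \<open>(0, 0, F)\<close> with \<open>F \<noteq> {}\<close> forces
  \<open>i = j = 0\<close> and \<open>F \<subseteq> G\<close>, and testing it on \<open>(1, 1, F)\<close> forces \<open>F \<subseteq> - 1 + G\<close>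
  (\<open>identity_class_components\<close>).  The first inclusion for all \<open>F\<close> gives \<open>G = \<Union>\<F>\<close>, and the second
  for \<open>F = G\<close> is inductivity.  If \<open>\<F>\<close> has no nonempty member, then \<open>\<F> = {{}}\<close>, the semigroup is
  trivial, and the empty set is the required inductive union.
\<close>

lemma B_class_eq_iff:
  assumes "x \<in> triples \<F>" "y \<in> triples \<F>"
  shows "B_class \<F> x = B_class \<F> y \<longleftrightarrow> x = y \<or> x \<in> zero_ideal \<F> \<and> y \<in> zero_ideal \<F>"
  using eq_equiv_class_iff[OF B_rel_equiv assms] assms
  by (auto simp: B_class_def rees_congruence_def)

lemma B_carrier_eq: "B_carrier \<F> = B_class \<F> ` triples \<F>"
  by (auto simp: B_carrier_def quotient_def B_class_def)

lemma omega_inductive_add: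
  assumes "omega_inductive A" "k \<in> A"
  shows "n + k \<in> A"
  using assms by (induction n) (auto simp: omega_inductive_def)

lemma is_identity_unique:
  assumes "is_identity S mul e" "is_identity S mul e'"
  shows "e = e'"
  using assms unfolding is_identity_def by metis

lemma union_inductive_identity:
  assumes "omega_closed \<F>" "F0 \<in> \<F>" "omega_inductive F0" "F0 = \<Union>\<F>"
  shows "is_identity (B_carrier \<F>) (B_mult \<F>) (B_class \<F> (0, 0, F0))"
proof -
  have e: "(0, 0, F0) \<in> triples \<F>"
    using assms(2) by (simp add: triples_def)
  have cap: "int_cap (shift (- int n) F0) F = F" if "F \<in> \<F>" for n F
  proof -
    have "n + k \<in> F0" if "k \<in> F" for k
      using omega_inductive_add[OF assms(3)] \<open>F \<in> \<F>\<close> that assms(4) by blast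
    then show ?thesis
      by (force simp: mem_int_cap_shift)
  qed
  have "triple_mult (0, 0, F0) x = x" if "x \<in> triples \<F>" for x
    using that cap by (auto simp: triples_def)
  moreover have "triple_mult x (0, 0, F0) = x" if "x \<in> triples \<F>" for x
    using that cap by (auto simp: triples_def triple_mult_ge simp del: triple_mult.simps)
  ultimately show ?thesis
    using e by (auto simp: is_identity_def B_carrier_eq B_mult_class[OF assms(1)])
qed

text \<open>
  The nonemptiness of \<open>F\<close> is what makes the equations between classes equations between
  triples: outside the zero ideal the classes are singletons.
\<close>

lemma identity_class_components:
  assumes "omega_closed \<F>" "(i, j, G) \<in> triples \<F>" "F \<in> \<F>" "F \<noteq> {}"
    and "is_identity (B_carrier \<F>) (B_mult \<F>) (B_class \<F> (i, j, G))"
  shows "i = 0" "j = 0" "F \<subseteq> G" "\<forall>k\<in>F. k + 1 \<in> G"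
proof -
  have fix_left: "triple_mult (i, j, G) (n, n, F) = (n, n, F)" for n
  proof -
    have y: "(n, n, F) \<in> triples \<F>" "(n, n, F) \<notin> zero_ideal \<F>"
      using assms(3,4) by (auto simp: triples_def zero_ideal_def)
    have "B_class \<F> (triple_mult (i, j, G) (n, n, F)) = B_class \<F> (n, n, F)"
      using assms(5) y(1)
      by (simp add: is_identity_def B_carrier_eq B_mult_class[OF assms(1,2) y(1), symmetric]
          del: triple_mult.simps)
    then show ?thesis
      using B_class_eq_iff[OF triple_mult_closed[OF assms(1,2) y(1)] y(1)] y(2) by blast
  qed
  show ij: "i = 0" "j = 0"
    using fix_left[of 0] by (auto simp: triple_mult_ge simp del: triple_mult.simps)
  have mem: "k + n \<in> G" if "k \<in> F" for k n
  proof -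
    have "int_cap (shift (- int n) G) F = F"
      using fix_left[of n] ij by simp
    then obtain l where "l \<in> G" "int k = - int n + int l"
      using \<open>k \<in> F\<close> mem_int_cap_shift by blast
    moreover from this have "l = k + n"
      by linarith
    ultimately show ?thesis
      by simp
  qed
  show "F \<subseteq> G" "\<forall>k\<in>F. k + 1 \<in> G"
    using mem[of _ 0] mem[of _ 1] by auto
qed

lemma identity_imp_union_inductive:
  assumes "\<F> \<noteq> {}" "omega_closed \<F>" "is_identity (B_carrier \<F>) (B_mult \<F>) e"
  shows "\<exists>F0\<in>\<F>. omega_inductive F0 \<and> F0 = \<Union>\<F>"
proof (cases "\<exists>F\<in>\<F>. F \<noteq> {}")
  case False
  then have "\<F> = {{}}"
    using assms(1) by auto
  then show ?thesis
    by (simp add: omega_inductive_def)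
next
  case True
  then obtain F where F: "F \<in> \<F>" "F \<noteq> {}"
    by blast
  from assms(3) obtain x where "x \<in> triples \<F>" "e = B_class \<F> x"
    by (auto simp: is_identity_def B_carrier_eq)
  then obtain i j G where x: "(i, j, G) \<in> triples \<F>" and e: "e = B_class \<F> (i, j, G)"
    by (metis prod_cases3)
  have comp: "H \<subseteq> G" "\<forall>k\<in>H. k + 1 \<in> G" if "H \<in> \<F>" "H \<noteq> {}" for H
    using identity_class_components[OF assms(2) x that] assms(3) e by simp_all
  have G: "G \<in> \<F>" "G \<noteq> {}"
    using x F comp(1)[OF F] by (auto simp: triples_def)
  have "G = \<Union>\<F>"
    using G comp(1) by blast
  moreover have "omega_inductive G"
    using comp(2)[OF G] by (simp add: omega_inductive_def)
  ultimately show ?thesis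
    using G(1) by blast
qed

theorem mainTheorem8:
  fixes \<F> :: "nat set set"
  assumes "\<F> \<noteq> {}" and "omega_closed \<F>"
  shows "((\<exists>e. is_identity (B_carrier \<F>) (B_mult \<F>) e) \<longleftrightarrow>
            (\<exists>F0\<in>\<F>. omega_inductive F0 \<and> F0 = \<Union>\<F>))
       \<and> (\<forall>F0\<in>\<F>. omega_inductive F0 \<and> F0 = \<Union>\<F> \<longrightarrow>
            (\<forall>e. is_identity (B_carrier \<F>) (B_mult \<F>) e \<longleftrightarrow> e = B_class \<F> (0, 0, F0)))"
  using identity_imp_union_inductive[OF assms] union_inductive_identity[OF assms(2)]
    is_identity_unique
  by metis

end
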